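(* Fix any $k\in\mathbb{N}$. For $\lambda>0$ let $n\ell_{k,\lambda}$ and $nd_{k,\lambda}$ be, respectively, the probability that the first player loses and the probability that the game is a draw, in the $k$-jump normal game started at the root of the Galton-Watson tree with Poisson$(\lambda)$ offspring distribution. Then $nd_{k,\lambda}>0$ for all $\lambda$ sufficiently large. Also, $\lambda^{k-1}\,n\ell_{k,\lambda}\to0$ as $\lambda\to\infty$.
   Context: Galton-Watson tree: the rooted random tree in which every vertex independently has a number of children with the given offspring distribution. For a vertex $u$, $\Gamma_k(u)$ is the set of descendants $v\neq u$ of $u$ at graph distance at most $k$ from $u$. In the $k$-jump normal game a token starts at a vertex; two players alternate moves, where a move relocates the token from its current vertex $u$ to any vertex of $\Gamma_k(u)$. A player unable to move loses. The whole tree is known to both players and both play optimally; a game that goes on forever is a draw. $\mathbb{N}=\{1,2,\dots\}$. *)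

theory Defs
  imports "HOL-Probability.Probability" "HOL-Library.Sublist"
begin

subsection \<open>Alternating-move games\<close>

text \<open>
  A game is given by its move function \<open>M\<close>: the mover relocates the token from \<open>u\<close> to
  some element of \<open>M u\<close>. A strategy maps the history of visited positions, in
  chronological order and ending with the current one, to the next position.
  The values of a strategy at positions without a move are irrelevant.
\<close>

definition legal_strategy :: "('v \<Rightarrow> 'v set) \<Rightarrow> ('v list \<Rightarrow> 'v) \<Rightarrow> bool" where
  "legal_strategy M s \<longleftrightarrow> (\<forall>h. h \<noteq> [] \<and> M (last h) \<noteq> {} \<longrightarrow> s h \<in> M (last h))"

text \<open>
  History after \<open>n\<close> turns when the players use \<open>s1\<close> and \<open>s2\<close>. The history stays constant
  once the mover is stuck, so as long as the game runs it has length \<open>n + 1\<close>.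
\<close>

primrec play ::
  "('v \<Rightarrow> 'v set) \<Rightarrow> ('v list \<Rightarrow> 'v) \<Rightarrow> ('v list \<Rightarrow> 'v) \<Rightarrow> 'v \<Rightarrow> nat \<Rightarrow> 'v list" where
  "play M s1 s2 v 0 = [v]"
| "play M s1 s2 v (Suc n) =
     (let h = play M s1 s2 v n
      in if M (last h) = {} then h else h @ [(if odd (length h) then s1 else s2) h])"

text \<open>
  The first player is to move exactly at the histories of odd length, and a player who
  is stuck at his own turn loses.
\<close>

definition first_stuck ::
  "('v \<Rightarrow> 'v set) \<Rightarrow> ('v list \<Rightarrow> 'v) \<Rightarrow> ('v list \<Rightarrow> 'v) \<Rightarrow> 'v \<Rightarrow> bool" where
  "first_stuck M s1 s2 v \<longleftrightarrow>
     (\<exists>n. M (last (play M s1 s2 v n)) = {} \<and> odd (length (play M s1 s2 v n)))"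

definition second_stuck ::
  "('v \<Rightarrow> 'v set) \<Rightarrow> ('v list \<Rightarrow> 'v) \<Rightarrow> ('v list \<Rightarrow> 'v) \<Rightarrow> 'v \<Rightarrow> bool" where
  "second_stuck M s1 s2 v \<longleftrightarrow>
     (\<exists>n. M (last (play M s1 s2 v n)) = {} \<and> even (length (play M s1 s2 v n)))"

definition first_wins :: "('v \<Rightarrow> 'v set) \<Rightarrow> 'v \<Rightarrow> bool" where
  "first_wins M v \<longleftrightarrow>
     (\<exists>s1. legal_strategy M s1 \<and> (\<forall>s2. legal_strategy M s2 \<longrightarrow> second_stuck M s1 s2 v))"

definition first_loses :: "('v \<Rightarrow> 'v set) \<Rightarrow> 'v \<Rightarrow> bool" where
  "first_loses M v \<longleftrightarrow>
     (\<exists>s2. legal_strategy M s2 \<and> (\<forall>s1. legal_strategy M s1 \<longrightarrow> first_stuck M s1 s2 v))"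

definition game_draw :: "('v \<Rightarrow> 'v set) \<Rightarrow> 'v \<Rightarrow> bool" where
  "game_draw M v \<longleftrightarrow> \<not> first_wins M v \<and> \<not> first_loses M v"

subsection \<open>Galton-Watson trees and the k-jump normal game\<close>

text \<open>
  Ulam-Harris encoding: the root is \<open>[]\<close>, the children of \<open>u\<close> are \<open>u @ [i]\<close> for
  \<open>i < N u\<close>. A child count \<open>N u\<close> is attached to every label \<open>u\<close>; the counts at labels
  outside the tree play no role.
\<close>

definition gw_tree :: "(nat list \<Rightarrow> nat) \<Rightarrow> nat list set" where
  "gw_tree N = {v. \<forall>i < length v. v ! i < N (take i v)}"

definition gw_measure :: "nat pmf \<Rightarrow> (nat list \<Rightarrow> nat) measure" where
  "gw_measure p = (\<Pi>\<^sub>M u\<in>UNIV. measure_pmf p)"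

text \<open>
  Descendants of \<open>u\<close> are the tree vertices properly extending \<open>u\<close>, and the graph distance
  from \<open>u\<close> to a descendant \<open>v\<close> is \<open>length v - length u\<close>.
\<close>

definition jumps :: "nat \<Rightarrow> (nat list \<Rightarrow> nat) \<Rightarrow> nat list \<Rightarrow> nat list set" where
  "jumps k N u = {v \<in> gw_tree N. strict_prefix u v \<and> length v \<le> length u + k}"

definition nl :: "nat \<Rightarrow> real \<Rightarrow> real" where
  "nl k l = measure (gw_measure (poisson_pmf l))
     {N \<in> space (gw_measure (poisson_pmf l)). first_loses (jumps k N) []}"

definition nd :: "nat \<Rightarrow> real \<Rightarrow> real" where
  "nd k l = measure (gw_measure (poisson_pmf l))
     {N \<in> space (gw_measure (poisson_pmf l)). game_draw (jumps k N) []}"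

end

theory Submission
  imports Defs "HOL-Real_Asymp.Real_Asymp"
begin

text \<open>
  Call a position lost if the player to move there can be forced to get stuck. Since every
  position has finitely many moves, a lost position is lost within a bounded number of rounds
  (\<open>lost_iff\<close>), and the game values are determined by the set of lost positions: the first
  player loses exactly at lost positions and wins exactly when he can jump to one
  (\<open>first_loses_iff_lost\<close>, \<open>first_wins_iff_move_to_lost\<close>).

  Let \<open>x\<^sub>n\<close> be the probability that the root is lost within \<open>n\<close> rounds, and let the
  offspring mean be \<open>l \<ge> 1\<close>. If the root is lost within \<open>n + 1\<close> rounds, then each child
  \<open>v\<close> of the root, being a legal move when \<open>k \<ge> 1\<close>, can jump to a position lost within \<open>n\<close>
  rounds. The subtrees of the children are independent copies of the whole tree, so with \<open>q\<close>
  the probability that the root can jump to a position lost within \<open>n\<close> rounds,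
  \<open>x\<^sub>n\<^sub>+\<^sub>1 \<le> exp (- l (1 - q))\<close>, the probability generating function of the
  Poisson law at \<open>q\<close>. There are \<open>l ^ j\<close> descendants at distance \<open>j\<close> on average, hence
  \<open>q \<le> (l + \<dots> + l ^ k) x\<^sub>n \<le> k l ^ k x\<^sub>n\<close>.

  Once \<open>l\<close> is so large that \<open>k l ^ k exp (- l / 2) \<le> 1 / 2\<close>, the bound
  \<open>x\<^sub>n \<le> exp (- l / 2)\<close> passes from \<open>n\<close> to \<open>n + 1\<close>, and it starts from
  \<open>x\<^sub>0 = 0\<close>. In the limit the first player loses with probability at most
  \<open>exp (- l / 2)\<close>, which beats every power of \<open>l\<close>. Jumping to a lost position is then
  unlikely too, by the same bound on \<open>q\<close>, so the first player wins with small probability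
  and a draw has probability tending to \<open>1\<close>.
\<close>

section \<open>Positions lost in boundedly many rounds\<close>

text \<open>
  A round is one turn of the player to move at \<open>u\<close> together with the reply. The turn at which
  that player is found stuck counts as a round, so that nothing is lost within \<open>0\<close> rounds.
\<close>

primrec loses_within :: "('v \<Rightarrow> 'v set) \<Rightarrow> nat \<Rightarrow> 'v \<Rightarrow> bool" where
  "loses_within M 0 u \<longleftrightarrow> False"
| "loses_within M (Suc n) u \<longleftrightarrow> (\<forall>v\<in>M u. \<exists>w\<in>M v. loses_within M n w)"

definition lost :: "('v \<Rightarrow> 'v set) \<Rightarrow> 'v \<Rightarrow> bool" where
  "lost M u \<longleftrightarrow> (\<exists>n. loses_within M n u)"

lemma loses_within_Suc: "loses_within M n u \<Longrightarrow> loses_within M (Suc n) u"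
proof (induction n arbitrary: u)
  case (Suc n)
  then show ?case
    unfolding loses_within.simps(2)[of M "Suc n"] by (metis loses_within.simps(2))
qed simp

lemma loses_within_mono: "loses_within M m u \<Longrightarrow> m \<le> n \<Longrightarrow> loses_within M n u"
  by (rotate_tac, induction n rule: dec_induct) (blast intro: loses_within_Suc)+

text \<open>
  With finitely many moves the bounds for the individual moves have a maximum, so that a
  position from which every move allows a reply to a lost position is itself lost within a
  bounded number of rounds. Without finiteness there could be forced wins whose duration has no bound.
\<close>

lemma lost_iff:
  assumes "finite (M u)"
  shows "lost M u \<longleftrightarrow> (\<forall>v\<in>M u. \<exists>w\<in>M v. lost M w)"
proof
  assume "lost M u"
  then obtain n where "loses_within M n u" by (auto simp: lost_def)
  then show "\<forall>v\<in>M u. \<exists>w\<in>M v. lost M w"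
    unfolding lost_def by (cases n) (simp, metis loses_within.simps(2))
next
  assume "\<forall>v\<in>M u. \<exists>w\<in>M v. lost M w"
  then obtain r where r: "\<And>v. v \<in> M u \<Longrightarrow> \<exists>w\<in>M v. loses_within M (r v) w"
    unfolding lost_def by metis
  have "\<exists>w\<in>M v. loses_within M (Max (r ` M u)) w" if "v \<in> M u" for v
  proof -
    have "r v \<le> Max (r ` M u)" using that assms by simp
    then show ?thesis using r[OF that] loses_within_mono by metis
  qed
  then have "loses_within M (Suc (Max (r ` M u))) u" by simp
  then show "lost M u" unfolding lost_def by blast
qed

lemma lost_if_stuck: "M u = {} \<Longrightarrow> lost M u"
  unfolding lost_def by (rule exI[of _ "Suc 0"]) simp

section \<open>Positional strategies\<close>

text \<open>
  Moving to a position that is lost in the fewest possible rounds works for all bounds \<open>n\<close>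
  simultaneously, so a single positional strategy forces every win.
\<close>

lemma exists_forcing_choice:
  obtains \<sigma> where "\<And>u. M u \<noteq> {} \<Longrightarrow> \<sigma> u \<in> M u"
    and "\<And>u w n. w \<in> M u \<Longrightarrow> loses_within M n w \<Longrightarrow> loses_within M n (\<sigma> u)"
proof -
  have "\<exists>x\<in>M u. \<forall>w n. w \<in> M u \<longrightarrow> loses_within M n w \<longrightarrow> loses_within M n x"
    if "M u \<noteq> {}" for u
  proof (cases "\<exists>n. \<exists>x\<in>M u. loses_within M n x")
    case True
    let ?n = "LEAST n. \<exists>x\<in>M u. loses_within M n x"
    obtain x where x: "x \<in> M u" "loses_within M ?n x"
      using LeastI_ex[OF True] by blast
    have "?n \<le> n" if "w \<in> M u" "loses_within M n w" for w n
      using that by (intro Least_le) blast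
    with x show ?thesis using loses_within_mono by metis
  next
    case False
    with that show ?thesis by blast
  qed
  then obtain \<sigma> where "\<And>u. M u \<noteq> {} \<Longrightarrow> \<sigma> u \<in> M u \<and>
      (\<forall>w n. w \<in> M u \<longrightarrow> loses_within M n w \<longrightarrow> loses_within M n (\<sigma> u))"
    by metis
  then show ?thesis by (intro that[of \<sigma>]) blast+
qed

text \<open>
  A move that leaves the opponent no jump to a lost position keeps the mover from losing. As
  such moves are described without reference to the past, one positional strategy makes
  them whenever they exist.
\<close>

lemma exists_evading_choice:
  obtains \<sigma> where "\<And>u. M u \<noteq> {} \<Longrightarrow> \<sigma> u \<in> M u"
    and "\<And>u v. v \<in> M u \<Longrightarrow> \<forall>w\<in>M v. \<not> lost M w \<Longrightarrow> \<forall>w\<in>M (\<sigma> u). \<not> lost M w"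
proof -
  have "\<exists>x\<in>M u. \<forall>v\<in>M u. (\<forall>w\<in>M v. \<not> lost M w) \<longrightarrow> (\<forall>w\<in>M x. \<not> lost M w)"
    if "M u \<noteq> {}" for u
    using that by (metis ex_in_conv)
  then obtain \<sigma> where "\<And>u. M u \<noteq> {} \<Longrightarrow> \<sigma> u \<in> M u \<and>
      (\<forall>v\<in>M u. (\<forall>w\<in>M v. \<not> lost M w) \<longrightarrow> (\<forall>w\<in>M (\<sigma> u). \<not> lost M w))"
    by metis
  then show ?thesis by (intro that[of \<sigma>]) blast+
qed

lemma legal_positional:
  "(\<And>u. M u \<noteq> {} \<Longrightarrow> \<sigma> u \<in> M u) \<Longrightarrow> legal_strategy M (\<lambda>h. \<sigma> (last h))"
  by (simp add: legal_strategy_def)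

lemma play_nonempty: "play M s1 s2 v n \<noteq> []"
  by (induction n) (auto simp: Let_def)

lemma play_step:
  assumes "legal_strategy M s1" "legal_strategy M s2" "M (last (play M s1 s2 v n)) \<noteq> {}"
  obtains w where "play M s1 s2 v (Suc n) = play M s1 s2 v n @ [w]"
    and "w \<in> M (last (play M s1 s2 v n))"
    and "w = (if odd (length (play M s1 s2 v n)) then s1 else s2) (play M s1 s2 v n)"
  using assms play_nonempty[of M s1 s2 v n] by (auto simp: Let_def legal_strategy_def)

text \<open>
  The Boolean \<open>b\<close> names a player: \<open>True\<close> is the first player, who moves at histories of odd
  length. This lets one lemma serve both players. If player \<open>b\<close> makes forcing choices and his
  opponent is to move at a position lost within \<open>n\<close> rounds, then the opponent is stuck or, two
  turns later, faces a position lost within one round less.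
\<close>

lemma forcing_wins:
  assumes legal: "legal_strategy M s1" "legal_strategy M s2"
    and own: "(if b then s1 else s2) = (\<lambda>h. \<sigma> (last h))"
    and forcing: "\<And>u w n. w \<in> M u \<Longrightarrow> loses_within M n w \<Longrightarrow> loses_within M n (\<sigma> u)"
  shows "loses_within M n (last (play M s1 s2 v m)) \<Longrightarrow> odd (length (play M s1 s2 v m)) \<noteq> b \<Longrightarrow>
    \<exists>m'. M (last (play M s1 s2 v m')) = {} \<and> odd (length (play M s1 s2 v m')) \<noteq> b"
proof (induction n arbitrary: m)
  case 0
  then show ?case by simp
next
  case (Suc n)
  let ?h = "play M s1 s2 v"
  show ?case
  proof (cases "M (last (?h m)) = {}")
    case True
    with Suc.prems show ?thesis by blast
  next
    case False
    obtain w where w: "?h (Suc m) = ?h m @ [w]" "w \<in> M (last (?h m))"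
      by (rule play_step[OF legal False])
    with Suc.prems obtain x where x: "x \<in> M w" "loses_within M n x" by auto
    then have ne: "M (last (?h (Suc m))) \<noteq> {}" using w by auto
    obtain y where y: "?h (Suc (Suc m)) = ?h (Suc m) @ [y]"
      "y = (if odd (length (?h (Suc m))) then s1 else s2) (?h (Suc m))"
      by (rule play_step[OF legal ne])
    have "odd (length (?h (Suc m))) = b" using w Suc.prems by auto
    then have "y = \<sigma> w" using y(2) own w(1) by simp
    then have "loses_within M n (last (?h (Suc (Suc m))))"
      using forcing[OF x] y(1) by simp
    moreover have "odd (length (?h (Suc (Suc m)))) \<noteq> b"
      using Suc.prems y(1) w(1) by simp
    ultimately show ?thesis by (rule Suc.IH)
  qed
qed

text \<open>
  The dual invariant: whenever the evading player \<open>b\<close> is to move he is not at a lost position,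
  and whenever his opponent is to move the opponent has no jump to a lost position. The first
  part gives the second one turn later by \<open>lost_iff\<close>, and the converse passage is immediate.
\<close>

lemma evading_invariant:
  assumes legal: "legal_strategy M s1" "legal_strategy M s2"
    and fin: "\<And>u. finite (M u)"
    and own: "(if b then s1 else s2) = (\<lambda>h. \<sigma> (last h))"
    and evading: "\<And>u v. v \<in> M u \<Longrightarrow> \<forall>w\<in>M v. \<not> lost M w \<Longrightarrow> \<forall>w\<in>M (\<sigma> u). \<not> lost M w"
    and start: "if b then \<not> lost M v else \<forall>w\<in>M v. \<not> lost M w"
  shows "if odd (length (play M s1 s2 v m)) = b then \<not> lost M (last (play M s1 s2 v m))
    else \<forall>w\<in>M (last (play M s1 s2 v m)). \<not> lost M w"
proof (induction m)
  case 0
  then show ?case using start by (cases b) auto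
next
  case (Suc m)
  let ?h = "play M s1 s2 v"
  show ?case
  proof (cases "M (last (?h m)) = {}")
    case True
    then have "?h (Suc m) = ?h m" by (simp add: Let_def)
    then show ?thesis using Suc.IH by simp
  next
    case False
    obtain w where w: "?h (Suc m) = ?h m @ [w]" "w \<in> M (last (?h m))"
      "w = (if odd (length (?h m)) then s1 else s2) (?h m)"
      by (rule play_step[OF legal False])
    show ?thesis
    proof (cases "odd (length (?h m)) = b")
      case True
      with Suc.IH have "\<not> lost M (last (?h m))" by simp
      then obtain x where "x \<in> M (last (?h m))" "\<forall>y\<in>M x. \<not> lost M y"
        using lost_iff[of M "last (?h m)"] fin by blast
      then have "\<forall>y\<in>M (\<sigma> (last (?h m))). \<not> lost M y" by (rule evading)
      moreover have "w = \<sigma> (last (?h m))" using w(3) own True by simp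
      ultimately show ?thesis using True w(1) by auto
    next
      case False
      then show ?thesis using Suc.IH w(1,2) by auto
    qed
  qed
qed

lemma evading_not_stuck:
  assumes "legal_strategy M s1" "legal_strategy M s2"
    and "\<And>u. finite (M u)"
    and "(if b then s1 else s2) = (\<lambda>h. \<sigma> (last h))"
    and "\<And>u v. v \<in> M u \<Longrightarrow> \<forall>w\<in>M v. \<not> lost M w \<Longrightarrow> \<forall>w\<in>M (\<sigma> u). \<not> lost M w"
    and "if b then \<not> lost M v else \<forall>w\<in>M v. \<not> lost M w"
    and "odd (length (play M s1 s2 v m)) = b"
  shows "M (last (play M s1 s2 v m)) \<noteq> {}"
proof -
  have "if odd (length (play M s1 s2 v m)) = b then \<not> lost M (last (play M s1 s2 v m))
    else \<forall>w\<in>M (last (play M s1 s2 v m)). \<not> lost M w"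
    by (rule evading_invariant[OF assms(1-4) _ assms(6)]) (rule assms(5))
  with assms(7) show ?thesis using lost_if_stuck[of M] by auto
qed

lemma first_loses_iff_lost:
  assumes fin: "\<And>u. finite (M u)"
  shows "first_loses M v \<longleftrightarrow> lost M v"
proof
  assume "lost M v"
  then obtain n where n: "loses_within M n v" by (auto simp: lost_def)
  obtain \<sigma> where \<sigma>: "\<And>u. M u \<noteq> {} \<Longrightarrow> \<sigma> u \<in> M u"
    "\<And>u w n. w \<in> M u \<Longrightarrow> loses_within M n w \<Longrightarrow> loses_within M n (\<sigma> u)"
    using exists_forcing_choice[of M] by metis
  have legal: "legal_strategy M (\<lambda>h. \<sigma> (last h))" by (rule legal_positional) (rule \<sigma>(1))
  have "first_stuck M s1 (\<lambda>h. \<sigma> (last h)) v" if "legal_strategy M s1" for s1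
    using forcing_wins[OF that legal, of False \<sigma> n v 0] \<sigma>(2) n
    by (auto simp: first_stuck_def)
  with legal show "first_loses M v" unfolding first_loses_def by blast
next
  assume "first_loses M v"
  then obtain s2 where s2: "legal_strategy M s2"
    "\<And>s1. legal_strategy M s1 \<Longrightarrow> first_stuck M s1 s2 v"
    unfolding first_loses_def by blast
  obtain \<sigma> where \<sigma>: "\<And>u. M u \<noteq> {} \<Longrightarrow> \<sigma> u \<in> M u"
    "\<And>u v. v \<in> M u \<Longrightarrow> \<forall>w\<in>M v. \<not> lost M w \<Longrightarrow> \<forall>w\<in>M (\<sigma> u). \<not> lost M w"
    using exists_evading_choice[of M] by metis
  have legal: "legal_strategy M (\<lambda>h. \<sigma> (last h))" by (rule legal_positional) (rule \<sigma>(1))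
  show "lost M v"
  proof (rule ccontr)
    assume "\<not> lost M v"
    then have start: "if True then \<not> lost M v else \<forall>w\<in>M v. \<not> lost M w" by simp
    have "M (last (play M (\<lambda>h. \<sigma> (last h)) s2 v m)) \<noteq> {}"
      if "odd (length (play M (\<lambda>h. \<sigma> (last h)) s2 v m)) = True" for m
      using legal s2(1) fin if_True \<sigma>(2) start that by (rule evading_not_stuck)
    with s2(2)[OF legal] show False unfolding first_stuck_def by blast
  qed
qed

lemma first_wins_iff_move_to_lost:
  assumes fin: "\<And>u. finite (M u)"
  shows "first_wins M v \<longleftrightarrow> (\<exists>w\<in>M v. lost M w)"
proof
  assume "\<exists>w\<in>M v. lost M w"
  then obtain w n where n: "w \<in> M v" "loses_within M n w" by (auto simp: lost_def)
  obtain \<sigma> where \<sigma>: "\<And>u. M u \<noteq> {} \<Longrightarrow> \<sigma> u \<in> M u"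
    "\<And>u w n. w \<in> M u \<Longrightarrow> loses_within M n w \<Longrightarrow> loses_within M n (\<sigma> u)"
    using exists_forcing_choice[of M] by metis
  have legal: "legal_strategy M (\<lambda>h. \<sigma> (last h))" by (rule legal_positional) (rule \<sigma>(1))
  have "second_stuck M (\<lambda>h. \<sigma> (last h)) s2 v" if "legal_strategy M s2" for s2
  proof -
    have "play M (\<lambda>h. \<sigma> (last h)) s2 v 1 = [v, \<sigma> v]" using n by (auto simp: Let_def)
    then show ?thesis
      using forcing_wins[OF legal that, of True \<sigma> n v 1] \<sigma>(2) n
      by (auto simp: second_stuck_def)
  qed
  with legal show "first_wins M v" unfolding first_wins_def by blast
next
  assume "first_wins M v"
  then obtain s1 where s1: "legal_strategy M s1"
    "\<And>s2. legal_strategy M s2 \<Longrightarrow> second_stuck M s1 s2 v"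
    unfolding first_wins_def by blast
  obtain \<sigma> where \<sigma>: "\<And>u. M u \<noteq> {} \<Longrightarrow> \<sigma> u \<in> M u"
    "\<And>u v. v \<in> M u \<Longrightarrow> \<forall>w\<in>M v. \<not> lost M w \<Longrightarrow> \<forall>w\<in>M (\<sigma> u). \<not> lost M w"
    using exists_evading_choice[of M] by metis
  have legal: "legal_strategy M (\<lambda>h. \<sigma> (last h))" by (rule legal_positional) (rule \<sigma>(1))
  show "\<exists>w\<in>M v. lost M w"
  proof (rule ccontr)
    assume "\<not> (\<exists>w\<in>M v. lost M w)"
    then have start: "if False then \<not> lost M v else \<forall>w\<in>M v. \<not> lost M w" by simp
    have "M (last (play M s1 (\<lambda>h. \<sigma> (last h)) v m)) \<noteq> {}"
      if "odd (length (play M s1 (\<lambda>h. \<sigma> (last h)) v m)) = False" for m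
      using s1(1) legal fin if_False \<sigma>(2) start that by (rule evading_not_stuck)
    with s1(2)[OF legal] show False unfolding second_stuck_def by blast
  qed
qed

section \<open>Subtrees\<close>

definition subtree :: "nat list \<Rightarrow> (nat list \<Rightarrow> nat) \<Rightarrow> nat list \<Rightarrow> nat" where
  "subtree w N = (\<lambda>u. N (w @ u))"

lemma subtree_Nil [simp]: "subtree [] N = N"
  by (simp add: subtree_def)

lemma subtree_append: "subtree (v @ w) N = subtree w (subtree v N)"
  by (simp add: subtree_def)

lemma Nil_in_gw_tree [simp]: "[] \<in> gw_tree N"
  by (simp add: gw_tree_def)

lemma Cons_in_gw_tree: "i # u \<in> gw_tree N \<longleftrightarrow> i < N [] \<and> u \<in> gw_tree (subtree [i] N)"
  by (simp add: gw_tree_def subtree_def All_less_Suc2)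

text \<open>
  With \<open>jumps_append\<close> below, this says that what happens below a tree vertex \<open>w\<close> depends on
  the counts in its subtree only.
\<close>

lemma append_in_gw_tree:
  "w @ u \<in> gw_tree N \<longleftrightarrow> w \<in> gw_tree N \<and> u \<in> gw_tree (subtree w N)"
proof (induction w arbitrary: N)
  case (Cons i w)
  then show ?case
    using subtree_append[of "[i]" w N] by (simp add: Cons_in_gw_tree)
qed simp

lemma finite_gw_tree_upto: "finite {v \<in> gw_tree N. length v \<le> n}"
proof (induction n arbitrary: N)
  case 0
  have "{v \<in> gw_tree N. length v \<le> 0} \<subseteq> {[]}" by auto
  then show ?case by (rule finite_subset) simp
next
  case (Suc n)
  have "{v \<in> gw_tree N. length v \<le> Suc n} \<subseteq>
      insert [] (\<Union>i<N []. (#) i ` {v \<in> gw_tree (subtree [i] N). length v \<le> n})"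
  proof
    fix v assume "v \<in> {v \<in> gw_tree N. length v \<le> Suc n}"
    then show "v \<in> insert [] (\<Union>i<N []. (#) i ` {v \<in> gw_tree (subtree [i] N). length v \<le> n})"
      by (cases v) (auto simp: Cons_in_gw_tree)
  qed
  then show ?case by (rule finite_subset) (simp add: Suc.IH)
qed

lemma finite_jumps: "finite (jumps k N u)"
  by (rule finite_subset[OF _ finite_gw_tree_upto[of N "length u + k"]]) (auto simp: jumps_def)

lemma jumps_append:
  assumes "w \<in> gw_tree N"
  shows "jumps k N (w @ u) = (@) w ` jumps k (subtree w N) u"
proof (intro equalityI subsetI)
  fix x assume x: "x \<in> jumps k N (w @ u)"
  then obtain z where "x = w @ u @ z"
    by (auto simp: jumps_def strict_prefix_def prefix_def)
  with x show "x \<in> (@) w ` jumps k (subtree w N) u"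
    by (auto simp: jumps_def append_in_gw_tree[of w] strict_prefix_def)
next
  fix x assume "x \<in> (@) w ` jumps k (subtree w N) u"
  with assms show "x \<in> jumps k N (w @ u)"
    by (auto simp: jumps_def append_in_gw_tree[of w] strict_prefix_def)
qed

lemma loses_within_append:
  assumes "w \<in> gw_tree N"
  shows "loses_within (jumps k N) n (w @ u) \<longleftrightarrow> loses_within (jumps k (subtree w N)) n u"
  by (induction n arbitrary: u) (simp_all add: jumps_append[OF assms])

lemma loses_within_subtree:
  "w \<in> gw_tree N \<Longrightarrow>
    loses_within (jumps k N) n w \<longleftrightarrow> loses_within (jumps k (subtree w N)) n []"
  using loses_within_append[of w N k n "[]"] by simp

lemma lost_subtree:
  "w \<in> gw_tree N \<Longrightarrow> lost (jumps k N) w \<longleftrightarrow> lost (jumps k (subtree w N)) []"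
  unfolding lost_def using loses_within_subtree by blast

text \<open>
  The counts for which some vertex at distance \<open>j\<close> from the root sees in its subtree an
  element of \<open>A\<close>. Existence in a generation can be decomposed over the children of the root,
  which is what makes its probability computable by recursion on \<open>j\<close>.
\<close>

definition occurs_at :: "nat \<Rightarrow> (nat list \<Rightarrow> nat) set \<Rightarrow> (nat list \<Rightarrow> nat) set" where
  "occurs_at j A = {N. \<exists>w\<in>gw_tree N. length w = j \<and> subtree w N \<in> A}"

lemma occurs_at_0 [simp]: "occurs_at 0 A = A"
  by (auto simp: occurs_at_def)

lemma occurs_at_Suc:
  "occurs_at (Suc j) A = {N. \<exists>i<N []. subtree [i] N \<in> occurs_at j A}" (is "?L = ?R")
proof (intro equalityI subsetI)
  fix N assume "N \<in> ?L"
  then obtain w where w: "w \<in> gw_tree N" "length w = Suc j" "subtree w N \<in> A"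
    by (auto simp: occurs_at_def)
  then obtain i u where "w = i # u" by (cases w) auto
  with w show "N \<in> ?R"
    using subtree_append[of "[i]" u N] by (auto simp: Cons_in_gw_tree occurs_at_def)
next
  fix N assume "N \<in> ?R"
  then obtain i u where "i < N []" "u \<in> gw_tree (subtree [i] N)" "length u = j"
    "subtree u (subtree [i] N) \<in> A"
    by (auto simp: occurs_at_def)
  then show "N \<in> ?L"
    unfolding occurs_at_def using subtree_append[of "[i]" u N]
    by (auto simp: Cons_in_gw_tree intro!: bexI[of _ "i # u"])
qed

lemma jump_to_eq_Union_occurs_at:
  "{N. \<exists>w\<in>jumps k N []. subtree w N \<in> A} = (\<Union>j\<in>{1..k}. occurs_at j A)"
proof -
  have "w \<in> jumps k N [] \<longleftrightarrow> w \<in> gw_tree N \<and> length w \<in> {1..k}" for N w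
    by (auto simp: jumps_def Suc_le_eq strict_prefix_def)
  then show ?thesis by (fastforce simp: occurs_at_def)
qed

section \<open>Measurability and the branching property\<close>

lemma space_gw_measure [simp]: "space (gw_measure p) = UNIV"
  by (simp add: gw_measure_def space_PiM)

lemma prob_space_gw_measure: "prob_space (gw_measure p)"
  unfolding gw_measure_def by (intro prob_space_PiM measure_pmf.prob_space_axioms)

lemma measurable_count [measurable]: "(\<lambda>N. N u) \<in> measurable (gw_measure p) (count_space UNIV)"
proof -
  have "(\<lambda>N. N u) \<in> measurable (gw_measure p) (measure_pmf p)"
    unfolding gw_measure_def by (rule measurable_component_singleton) simp
  then show ?thesis by simp
qed

lemma measurable_subtree [measurable]: "subtree w \<in> measurable (gw_measure p) (gw_measure p)"
proof -
  have "(\<lambda>N u. N (w @ u)) \<in> measurable (gw_measure p) (\<Pi>\<^sub>M u\<in>UNIV. measure_pmf p)"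
    by (rule measurable_PiM_single') (auto simp: measurable_count)
  then show ?thesis by (simp add: gw_measure_def subtree_def[abs_def])
qed

lemma measurable_in_gw_tree [measurable]: "Measurable.pred (gw_measure p) (\<lambda>N. v \<in> gw_tree N)"
proof -
  have [measurable]: "Measurable.pred (gw_measure p) (\<lambda>N. m < N u)" for m u
    by (rule measurable_compose[OF measurable_count]) simp
  show ?thesis unfolding gw_tree_def mem_Collect_eq by measurable
qed

lemma measurable_in_jumps: "Measurable.pred (gw_measure p) (\<lambda>N. v \<in> jumps k N u)"
  unfolding jumps_def mem_Collect_eq by measurable

lemma measurable_loses_within [measurable]:
  "Measurable.pred (gw_measure p) (\<lambda>N. loses_within (jumps k N) n u)"
proof (induction n arbitrary: u)
  case (Suc n)
  show ?case unfolding loses_within.simps Ball_def Bex_def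
    by (intro pred_intros_countable pred_intros_logic measurable_in_jumps Suc)
qed simp

lemma measurable_lost [measurable]: "Measurable.pred (gw_measure p) (\<lambda>N. lost (jumps k N) u)"
  unfolding lost_def by measurable

lemma sets_occurs_at [measurable]:
  assumes [measurable]: "A \<in> sets (gw_measure p)"
  shows "occurs_at j A \<in> sets (gw_measure p)"
proof -
  have "{N \<in> space (gw_measure p). \<exists>w. w \<in> gw_tree N \<and> length w = j \<and> subtree w N \<in> A}
      \<in> sets (gw_measure p)"
    by measurable
  then show ?thesis by (simp add: occurs_at_def Bex_def)
qed

lemma sets_jump_to:
  assumes [measurable]: "A \<in> sets (gw_measure p)"
  shows "{N. \<exists>w\<in>jumps k N []. subtree w N \<in> A} \<in> sets (gw_measure p)"
  unfolding jump_to_eq_Union_occurs_at by measurable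

lemma distr_subtree_child: "distr (gw_measure p) (gw_measure p) (subtree [i]) = gw_measure p"
  using distr_PiM_reindex[of UNIV "\<lambda>_. measure_pmf p" "Cons i" UNIV]
  by (simp add: gw_measure_def subtree_def[abs_def] restrict_def measure_pmf.prob_space_axioms)

lemma measure_subtree_child:
  assumes "C \<in> sets (gw_measure p)"
  shows "measure (gw_measure p) {N. subtree [i] N \<in> C} = measure (gw_measure p) C"
  using measure_distr[OF measurable_subtree assms, of "[i]"]
  by (simp add: distr_subtree_child vimage_def)

lemma measure_root_count: "measure (gw_measure p) {N. N [] = m} = pmf p m"
proof -
  have "distr (gw_measure p) (measure_pmf p) (\<lambda>N. N []) = measure_pmf p"
    unfolding gw_measure_def by (rule distr_PiM_component) (auto intro: measure_pmf.prob_space_axioms)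
  then have "pmf p m = measure (distr (gw_measure p) (measure_pmf p) (\<lambda>N. N [])) {m}"
    by (simp add: measure_pmf_single)
  also have "\<dots> = measure (gw_measure p) {N. N [] = m}"
    by (subst measure_distr) (auto simp: vimage_def)
  finally show ?thesis by simp
qed

lemma indep_counts:
  "prob_space.indep_vars (gw_measure p) (\<lambda>_. measure_pmf p) (\<lambda>u N. N u) UNIV"
proof -
  interpret prob_space "gw_measure p" by (rule prob_space_gw_measure)
  have 1: "distr (gw_measure p) (measure_pmf p) (\<lambda>N. N u) = measure_pmf p" for u
    unfolding gw_measure_def by (rule distr_PiM_component) (auto intro: measure_pmf.prob_space_axioms)
  show ?thesis
  proof (subst indep_vars_iff_distr_eq_PiM')
    show "distr (gw_measure p) (\<Pi>\<^sub>M u\<in>UNIV. measure_pmf p) (\<lambda>N. \<lambda>u\<in>UNIV. N u) =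
      (\<Pi>\<^sub>M u\<in>UNIV. distr (gw_measure p) (measure_pmf p) (\<lambda>N. N u))"
      unfolding 1 by (simp add: gw_measure_def restrict_def distr_id[simplified id_def])
  qed (auto intro: measurable_count)
qed

text \<open>
  The branching property. The labels split into the root and the sets of labels that start with
  a given \<open>i\<close>; restrictions of the family of counts to these disjoint blocks are independent,
  and each block below the root is a relabelled copy of the whole family.
\<close>

lemma measure_root_count_and_children:
  assumes C: "C \<in> sets (gw_measure p)"
  shows "measure (gw_measure p) {N. N [] = m \<and> (\<forall>i<m. subtree [i] N \<in> C)}
    = pmf p m * measure (gw_measure p) C ^ m"
proof -
  interpret prob_space "gw_measure p" by (rule prob_space_gw_measure)
  (* None is the block of the root, Some i that of the labels starting with i. *)
  define K :: "nat option \<Rightarrow> nat list set" where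
    "K = case_option {[]} (\<lambda>i. range (Cons i))"
  let ?P = "\<lambda>j. \<Pi>\<^sub>M u\<in>K j. measure_pmf p"
  let ?X = "\<lambda>j N. restrict N (K j)"
  have indep: "indep_vars ?P ?X UNIV"
    by (rule indep_vars_restrict[OF indep_counts])
       (auto simp: disjoint_family_on_def K_def split: option.splits)
  define A where "A = case_option ((\<lambda>x. x []) -` {m} \<inter> space (?P None))
    (\<lambda>i. (\<lambda>x u. x (i # u)) -` C \<inter> space (?P (Some i)))"
  have A: "A j \<in> sets (?P j)" for j
  proof (cases j)
    case None
    have "(\<lambda>x. x []) \<in> measurable (?P None) (measure_pmf p)"
      by (rule measurable_component_singleton) (simp add: K_def)
    then show ?thesis unfolding A_def None option.case by (rule measurable_sets) simp
  next
    case (Some i)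
    have "(\<lambda>x u. x (i # u)) \<in> measurable (?P (Some i)) (gw_measure p)"
      unfolding gw_measure_def
    proof (rule measurable_PiM_single')
      show "(\<lambda>x. x (i # u)) \<in> measurable (?P (Some i)) (measure_pmf p)" for u
        by (rule measurable_component_singleton) (simp add: K_def)
    qed simp
    then show ?thesis unfolding A_def Some option.case using C by (rule measurable_sets)
  qed
  have pre_None: "?X None -` A None \<inter> space (gw_measure p) = {N. N [] = m}"
  proof -
    have "?X None N \<in> A None \<longleftrightarrow> N [] = m" for N
      by (simp add: A_def K_def space_PiM)
    then show ?thesis by (simp add: vimage_def)
  qed
  have pre_Some: "?X (Some i) -` A (Some i) \<inter> space (gw_measure p) = {N. subtree [i] N \<in> C}" for i
  proof -
    have "(\<lambda>u. ?X (Some i) N (i # u)) = subtree [i] N" for N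
      by (simp add: K_def subtree_def)
    then have "?X (Some i) N \<in> A (Some i) \<longleftrightarrow> subtree [i] N \<in> C" for N
      by (simp add: A_def space_PiM)
    then show ?thesis by (simp add: vimage_def)
  qed
  let ?J = "insert None (Some ` {..<m})"
  have "{N. N [] = m \<and> (\<forall>i<m. subtree [i] N \<in> C)} =
      {N. N [] = m} \<inter> (\<Inter>i<m. {N. subtree [i] N \<in> C})"
    by auto
  also have "\<dots> = (\<Inter>j\<in>?J. ?X j -` A j \<inter> space (gw_measure p))"
    by (simp only: INT_insert image_image pre_None pre_Some)
  also have "prob \<dots> = (\<Prod>j\<in>?J. prob (?X j -` A j \<inter> space (gw_measure p)))"
    by (rule indep_varsD[OF indep]) (auto intro: A)
  also have "\<dots> = prob {N. N [] = m} * (\<Prod>i<m. prob {N. subtree [i] N \<in> C})"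
  proof (subst prod.insert)
    show "finite (Some ` {..<m})" "None \<notin> Some ` {..<m}" by auto
    have "inj_on Some {..<m}" by simp
    show "prob (?X None -` A None \<inter> space (gw_measure p)) *
        (\<Prod>j\<in>Some ` {..<m}. prob (?X j -` A j \<inter> space (gw_measure p))) =
      prob {N. N [] = m} * (\<Prod>i<m. prob {N. subtree [i] N \<in> C})"
      unfolding prod.reindex[OF \<open>inj_on Some {..<m}\<close>] comp_def pre_None pre_Some by (rule refl)
  qed
  also have "\<dots> = pmf p m * prob C ^ m"
    by (simp add: measure_root_count measure_subtree_child[OF C])
  finally show ?thesis .
qed

lemma sums_all_children:
  assumes C: "C \<in> sets (gw_measure p)"
  shows "(\<lambda>m. pmf p m * measure (gw_measure p) C ^ m) sums
    measure (gw_measure p) {N. \<forall>i<N []. subtree [i] N \<in> C}"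
proof -
  interpret prob_space "gw_measure p" by (rule prob_space_gw_measure)
  let ?E = "\<lambda>m. {N. N [] = m \<and> (\<forall>i<m. subtree [i] N \<in> C)}"
  note [measurable] = C
  have "{N \<in> space (gw_measure p). N [] = m \<and> (\<forall>i<m. subtree [i] N \<in> C)} \<in> events" for m
    by measurable
  then have "range ?E \<subseteq> events" by auto
  then have "(\<lambda>m. prob (?E m)) sums prob (\<Union>m. ?E m)"
    by (rule finite_measure_UNION) (auto simp: disjoint_family_on_def)
  moreover have "(\<Union>m. ?E m) = {N. \<forall>i<N []. subtree [i] N \<in> C}" by auto
  ultimately show ?thesis by (simp add: measure_root_count_and_children[OF C])
qed

text \<open>
  The Poisson generating function \<open>q \<mapsto> exp (- l (1 - q))\<close> appears here, and all
  that follows about the Poisson law is drawn from this formula.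
\<close>

lemma measure_all_children_poisson:
  assumes l: "l > 0" and C: "C \<in> sets (gw_measure (poisson_pmf l))"
  shows "measure (gw_measure (poisson_pmf l)) {N. \<forall>i<N []. subtree [i] N \<in> C}
    = exp (- l * (1 - measure (gw_measure (poisson_pmf l)) C))"
proof -
  let ?q = "measure (gw_measure (poisson_pmf l)) C"
  have "(\<lambda>m. exp (- l) * ((l * ?q) ^ m /\<^sub>R fact m)) sums (exp (- l) * exp (l * ?q))"
    by (intro sums_mult exp_converges)
  moreover have "exp (- l) * ((l * ?q) ^ m /\<^sub>R fact m) = pmf (poisson_pmf l) m * ?q ^ m" for m
    using l by (simp add: power_mult_distrib field_simps)
  ultimately have "(\<lambda>m. pmf (poisson_pmf l) m * ?q ^ m) sums (exp (- l) * exp (l * ?q))"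
    by simp
  with sums_all_children[OF C] have
    "measure (gw_measure (poisson_pmf l)) {N. \<forall>i<N []. subtree [i] N \<in> C} = exp (- l) * exp (l * ?q)"
    by (rule sums_unique2)
  then show ?thesis by (simp add: exp_add[symmetric] algebra_simps)
qed

text \<open>
  This is the first moment bound for the generation of size \<open>l ^ j\<close> on average. In place of
  expectations it uses the exact probability that no child has the property, together with
  \<open>1 - exp (- x) \<le> x\<close>, once per generation.
\<close>

lemma measure_occurs_at_le:
  assumes l: "l > 0" and A: "A \<in> sets (gw_measure (poisson_pmf l))"
  shows "measure (gw_measure (poisson_pmf l)) (occurs_at j A)
    \<le> l ^ j * measure (gw_measure (poisson_pmf l)) A"
proof (induction j)
  case (Suc j)
  interpret prob_space "gw_measure (poisson_pmf l)" by (rule prob_space_gw_measure)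
  let ?B = "occurs_at j A"
  have B: "?B \<in> events" using A by measurable
  then have B': "- ?B \<in> events" using sets.compl_sets[OF B] by (simp add: Compl_eq_Diff_UNIV)
  have "prob (- ?B) = 1 - prob ?B" using prob_compl[OF B] by (simp add: Compl_eq_Diff_UNIV)
  then have "prob {N. \<forall>i<N []. subtree [i] N \<in> - ?B} = exp (- (l * prob ?B))"
    using measure_all_children_poisson[OF l B'] by simp
  moreover have "occurs_at (Suc j) A = space (gw_measure (poisson_pmf l)) - {N. \<forall>i<N []. subtree [i] N \<in> - ?B}"
    by (auto simp: occurs_at_Suc)
  moreover have "{N \<in> space (gw_measure (poisson_pmf l)). \<forall>i<N []. subtree [i] N \<in> - ?B} \<in> events"
    using B' by measurable
  ultimately have "prob (occurs_at (Suc j) A) = 1 - exp (- (l * prob ?B))"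
    by (simp add: prob_compl[simplified])
  also have "\<dots> \<le> l * prob ?B" using exp_ge_add_one_self[of "- (l * prob ?B)"] by simp
  also have "\<dots> \<le> l * (l ^ j * prob A)" using Suc.IH l by simp
  finally show ?case by (simp add: mult.assoc)
qed simp

lemma measure_jump_to_le:
  assumes l: "l \<ge> 1" and A: "A \<in> sets (gw_measure (poisson_pmf l))"
  shows "measure (gw_measure (poisson_pmf l)) {N. \<exists>w\<in>jumps k N []. subtree w N \<in> A}
    \<le> k * l ^ k * measure (gw_measure (poisson_pmf l)) A"
proof -
  interpret prob_space "gw_measure (poisson_pmf l)" by (rule prob_space_gw_measure)
  have "prob {N. \<exists>w\<in>jumps k N []. subtree w N \<in> A} = prob (\<Union>j\<in>{1..k}. occurs_at j A)"
    unfolding jump_to_eq_Union_occurs_at ..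
  also have "\<dots> \<le> (\<Sum>j\<in>{1..k}. prob (occurs_at j A))"
    using A by (intro finite_measure_subadditive_finite) auto
  also have "\<dots> \<le> (\<Sum>j\<in>{1..k}. l ^ k * prob A)"
  proof (rule sum_mono)
    fix j assume "j \<in> {1..k}"
    then have "l ^ j * prob A \<le> l ^ k * prob A"
      using l by (intro mult_right_mono power_increasing) auto
    with measure_occurs_at_le[OF _ A, of j] l show "prob (occurs_at j A) \<le> l ^ k * prob A"
      by simp
  qed
  finally show ?thesis by simp
qed

section \<open>Large offspring means\<close>

text \<open>
  The bound \<open>exp (- l / 2)\<close> reproduces itself: it makes a jump to a position lost within \<open>n\<close>
  rounds have probability at most \<open>1 / 2\<close>, and the probability that all children of the root
  have such a jump is then at most \<open>exp (- l (1 - 1 / 2))\<close>.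
\<close>

lemma measure_loses_within_le:
  assumes k: "k \<ge> 1" and l: "l \<ge> 1" and large: "real k * l ^ k * exp (- l / 2) \<le> 1 / 2"
  shows "measure (gw_measure (poisson_pmf l)) {N. loses_within (jumps k N) n []} \<le> exp (- l / 2)"
proof (induction n)
  case (Suc n)
  interpret prob_space "gw_measure (poisson_pmf l)" by (rule prob_space_gw_measure)
  define A where "A = {N. loses_within (jumps k N) n []}"
  define B where "B = {N. \<exists>w\<in>jumps k N []. subtree w N \<in> A}"
  have "{N \<in> space (gw_measure (poisson_pmf l)). loses_within (jumps k N) n []} \<in> events" by measurable
  then have A: "A \<in> events" by (simp add: A_def)
  have B: "B \<in> events" unfolding B_def using A by (rule sets_jump_to)
  have "prob B \<le> k * l ^ k * prob A"
    unfolding B_def by (rule measure_jump_to_le[OF l A])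
  also have "\<dots> \<le> k * l ^ k * exp (- l / 2)"
    using Suc.IH l by (intro mult_left_mono) (auto simp: A_def)
  finally have half: "prob B \<le> 1 / 2" using large by simp
  have "{N. loses_within (jumps k N) (Suc n) []} \<subseteq> {N. \<forall>i<N []. subtree [i] N \<in> B}"
  proof (intro subsetI CollectI allI impI)
    fix N i assume N: "N \<in> {N. loses_within (jumps k N) (Suc n) []}" and i: "i < N []"
    (* k >= 1 enters here: the child [i] is itself a legal move from the root. *)
    have child: "[i] \<in> gw_tree N" using i by (simp add: Cons_in_gw_tree)
    with k have "[i] \<in> jumps k N []" by (simp add: jumps_def)
    with N obtain w where "w \<in> jumps k N ([i] @ [])" "loses_within (jumps k N) n w"
      by auto
    then obtain u where u: "u \<in> jumps k (subtree [i] N) []"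
      "loses_within (jumps k N) n ([i] @ u)"
      unfolding jumps_append[OF child] by auto
    then have "loses_within (jumps k (subtree [i] N)) n u"
      by (simp only: loses_within_append[OF child])
    moreover have "u \<in> gw_tree (subtree [i] N)" using u by (simp add: jumps_def)
    ultimately have "subtree u (subtree [i] N) \<in> A"
      using loses_within_subtree[of u "subtree [i] N" k n] by (simp add: A_def)
    with u show "subtree [i] N \<in> B" unfolding B_def by blast
  qed
  moreover have "{N \<in> space (gw_measure (poisson_pmf l)). \<forall>i<N []. subtree [i] N \<in> B} \<in> events"
    using B by measurable
  ultimately have "prob {N. loses_within (jumps k N) (Suc n) []} \<le> prob {N. \<forall>i<N []. subtree [i] N \<in> B}"
    by (intro finite_measure_mono) auto
  also have "\<dots> = exp (- l * (1 - prob B))" using measure_all_children_poisson[OF _ B] l by simp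
  also have "\<dots> \<le> exp (- l / 2)"
    using half l mult_left_mono[of "1/2" "1 - prob B" l] by simp
  finally show ?case .
qed simp

lemma measure_lost_le:
  assumes "k \<ge> 1" "l \<ge> 1" "real k * l ^ k * exp (- l / 2) \<le> 1 / 2"
  shows "measure (gw_measure (poisson_pmf l)) {N. lost (jumps k N) []} \<le> exp (- l / 2)"
proof -
  interpret prob_space "gw_measure (poisson_pmf l)" by (rule prob_space_gw_measure)
  let ?A = "\<lambda>n. {N. loses_within (jumps k N) n []}"
  have "{N \<in> space (gw_measure (poisson_pmf l)). loses_within (jumps k N) n []} \<in> events" for n
    by measurable
  then have "range ?A \<subseteq> events" by auto
  moreover have "incseq ?A" by (auto simp: incseq_Suc_iff simp del: loses_within.simps intro: loses_within_Suc)
  ultimately have "(\<lambda>n. prob (?A n)) \<longlonglongrightarrow> prob (\<Union>n. ?A n)"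
    by (rule finite_Lim_measure_incseq)
  moreover have "(\<Union>n. ?A n) = {N. lost (jumps k N) []}" by (auto simp: lost_def)
  ultimately show ?thesis
    using measure_loses_within_le[OF assms] by (intro LIMSEQ_le_const2) auto
qed

lemma nl_eq: "nl k l = measure (gw_measure (poisson_pmf l)) {N. lost (jumps k N) []}"
  by (simp add: nl_def first_loses_iff_lost finite_jumps)

text \<open>
  The winning event is a jump to a lost position, so the first moment bound controls it by the
  losing probability.
\<close>

lemma nd_ge:
  assumes l: "l \<ge> 1"
  shows "nd k l \<ge> 1 - (1 + k * l ^ k) * nl k l"
proof -
  interpret prob_space "gw_measure (poisson_pmf l)" by (rule prob_space_gw_measure)
  define L where "L = {N. lost (jumps k N) []}"
  define W where "W = {N. \<exists>w\<in>jumps k N []. subtree w N \<in> L}"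
  have "{N \<in> space (gw_measure (poisson_pmf l)). lost (jumps k N) []} \<in> events" by measurable
  then have L: "L \<in> events" by (simp add: L_def)
  have W: "W \<in> events" unfolding W_def using L by (rule sets_jump_to)
  have "first_wins (jumps k N) [] \<longleftrightarrow> N \<in> W" for N
    unfolding first_wins_iff_move_to_lost[OF finite_jumps] W_def L_def mem_Collect_eq
    by (intro bex_cong refl lost_subtree) (simp add: jumps_def)
  then have "nd k l = prob (space (gw_measure (poisson_pmf l)) - (L \<union> W))"
    unfolding nd_def game_draw_def first_loses_iff_lost[OF finite_jumps]
    by (intro arg_cong[of _ _ prob]) (auto simp: L_def)
  also have "\<dots> = 1 - prob (L \<union> W)" using L W by (intro prob_compl) auto
  also have "\<dots> \<ge> 1 - (prob L + prob W)" using measure_Un_le[OF L W] by simp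
  finally have "nd k l \<ge> 1 - (prob L + prob W)" .
  moreover have "prob W \<le> k * l ^ k * prob L"
    unfolding W_def by (rule measure_jump_to_le[OF l L])
  moreover have "nl k l = prob L" by (simp add: nl_eq L_def)
  ultimately show ?thesis by (simp add: algebra_simps)
qed

lemma power_times_exp_neg_half_tendsto_0: "((\<lambda>l::real. l ^ m * exp (- l / 2)) \<longlongrightarrow> 0) at_top"
  by real_asymp

theorem theorem1p4:
  fixes k :: nat
  assumes "k \<ge> 1"
  shows "(\<forall>\<^sub>F l in at_top. nd k l > 0) \<and>
         ((\<lambda>l::real. l ^ (k - 1) * nl k l) \<longlongrightarrow> 0) at_top"
proof -
  note small = power_times_exp_neg_half_tendsto_0
  have large: "\<forall>\<^sub>F l in at_top. l \<ge> 1 \<and> (1 + real k * l ^ k) * exp (- l / 2) \<le> 1 / (2::real)"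
  proof -
    have "((\<lambda>l::real. l ^ 0 * exp (- l / 2) + real k * (l ^ k * exp (- l / 2))) \<longlongrightarrow> 0 + real k * 0) at_top"
      by (intro tendsto_intros small)
    then have "((\<lambda>l::real. (1 + real k * l ^ k) * exp (- l / 2)) \<longlongrightarrow> 0) at_top"
      by (simp add: algebra_simps)
    then have "\<forall>\<^sub>F l in at_top. (1 + real k * l ^ k) * exp (- l / 2) < 1 / (2::real)"
      by (rule order_tendstoD) simp
    with eventually_ge_at_top[of "1::real"] show ?thesis by eventually_elim auto
  qed
  have nl_le: "nl k l \<le> exp (- l / 2)"
    if "l \<ge> 1" "(1 + real k * l ^ k) * exp (- l / 2) \<le> 1 / 2" for l
  proof -
    have "real k * l ^ k * exp (- l / 2) \<le> (1 + real k * l ^ k) * exp (- l / 2)" by simp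
    with that(2) have "real k * l ^ k * exp (- l / 2) \<le> 1 / 2" by linarith
    with measure_lost_le[OF assms that(1)] show ?thesis by (simp add: nl_eq)
  qed
  have "\<forall>\<^sub>F l in at_top. nd k l > 0"
    using large
  proof eventually_elim
    case (elim l)
    then have "(1 + real k * l ^ k) * nl k l \<le> (1 + real k * l ^ k) * exp (- l / 2)"
      using nl_le by (intro mult_left_mono) auto
    with nd_ge[of l k] elim show ?case by linarith
  qed
  moreover have "((\<lambda>l. l ^ (k - 1) * nl k l) \<longlongrightarrow> 0) at_top"
  proof (rule tendsto_sandwich[OF _ _ tendsto_const small])
    show "\<forall>\<^sub>F l in at_top. 0 \<le> l ^ (k - 1) * nl k l"
      using large by eventually_elim (simp add: nl_def)
    show "\<forall>\<^sub>F l in at_top. l ^ (k - 1) * nl k l \<le> l ^ (k - 1) * exp (- l / 2)"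
      using large
    proof eventually_elim
      case (elim l)
      then show ?case using nl_le[of l] by (intro mult_left_mono) auto
    qed
  qed
  ultimately show ?thesis ..
qed

end
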